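(* Let $n,m$ be positive integers and let $r>0$. The Kummer shape $\mathbf{J}_{n:m}(R_{n:m}^{-1}(r))\subset\mathfrak{su}(2)^*\cong\mathbb{R}^3$ is the sphere of radius $r$ (that is, of radius $R_{n:m}(\mathbf{a})$ for any $\mathbf{a}\in R_{n:m}^{-1}(r)$) centered at the origin with the north and south poles removed: $$\mathbf{J}_{n:m}(R_{n:m}^{-1}(r))=\{(\mu_1,\mu_2,\mu_3)\in\mathbb{R}^3:\mu_1^2+\mu_2^2+\mu_3^2=r^2\}\setminus\{(0,0,r),(0,0,-r)\}.$$
   Context: $\mathbb{C}_\times=\mathbb{C}\setminus\{0\}$ and $\mathbb{C}_\times^2=\{(a_1,a_2):a_1,a_2\in\mathbb{C}_\times\}$. For positive integers $n,m$ define $R_{n:m}\colon\mathbb{C}_\times^2\to\mathbb{R}$ by $$R_{n:m}(\mathbf{a})=\frac12\left(\frac{|a_1|^2}{m}+\frac{|a_2|^2}{n}\right),$$ and $f_{n:m}\colon\mathbb{C}_\times^2\to\mathbb{C}_\times^2$ by $$f_{n:m}(a_1,a_2)=\left(\frac{a_1^m}{\sqrt m\,|a_1|^{m-1}},\frac{a_2^n}{\sqrt n\,|a_2|^{n-1}}\right).$$ Identify $\mathfrak{su}(2)$ with $\mathbb{R}^3$ by $i\begin{bmatrix}\xi_3&\xi_1+i\xi_2\\ \xi_1-i\xi_2&-\xi_3\end{bmatrix}\leftrightarrow(\xi_1,\xi_2,\xi_3)$, and $\mathfrak{su}(2)^*$ with $\mathfrak{su}(2)\cong\mathbb{R}^3$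 via the inner product $\langle\xi,\eta\rangle=\frac12\operatorname{tr}(\xi^*\eta)$. Let $\mathbf{J}_{1:1}\colon\mathbb{C}_\times^2\to\mathfrak{su}(2)^*\cong\mathbb{R}^3$ be $$\mathbf{J}_{1:1}(\mathbf{b})=\left(\operatorname{Re}(b_1\bar b_2),\operatorname{Im}(b_1\bar b_2),\tfrac12(|b_1|^2-|b_2|^2)\right)$$ and $\mathbf{J}_{n:m}:=\mathbf{J}_{1:1}\circ f_{n:m}$. The Kummer shape at level $r>0$ is the image $\mathbf{J}_{n:m}(R_{n:m}^{-1}(r))$ of the level set of $R_{n:m}$. The north and south poles are the points of the sphere on the $\mu_3$-axis. *)

theory Defs
  imports "HOL-Analysis.Analysis"
begin

definition Ctimes2 :: "(complex \<times> complex) set" where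
  "Ctimes2 = (UNIV - {0}) \<times> (UNIV - {0})"

text \<open>
  The maps below are meant on \<open>Ctimes2\<close> and for positive \<open>n\<close>, \<open>m\<close>. The index \<open>n:m\<close> is
  crossed: \<open>m\<close> belongs to the first coordinate and \<open>n\<close> to the second.
\<close>

definition R_nm :: "nat \<Rightarrow> nat \<Rightarrow> complex \<times> complex \<Rightarrow> real" where
  "R_nm n m = (\<lambda>(a1, a2). ((cmod a1)\<^sup>2 / real m + (cmod a2)\<^sup>2 / real n) / 2)"

definition f_nm :: "nat \<Rightarrow> nat \<Rightarrow> complex \<times> complex \<Rightarrow> complex \<times> complex" where
  "f_nm n m = (\<lambda>(a1, a2).
     (a1 ^ m / complex_of_real (sqrt (real m) * cmod a1 ^ (m - 1)),
      a2 ^ n / complex_of_real (sqrt (real n) * cmod a2 ^ (n - 1))))"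

text \<open>
  The dual of \<open>su(2)\<close> is represented by its coordinate space \<open>real ^ 3\<close>: the matrix
  \<open>i [[\<xi>3, \<xi>1 + i \<xi>2], [\<xi>1 - i \<xi>2, - \<xi>3]]\<close> has coordinates \<open>(\<xi>1, \<xi>2, \<xi>3)\<close>, and the dual is
  identified with \<open>su(2)\<close> by the inner product \<open>tr (\<xi>\<^sup>* \<eta>) / 2\<close>, which is the standard inner
  product in these coordinates.
\<close>

definition J_11 :: "complex \<times> complex \<Rightarrow> real ^ 3" where
  "J_11 = (\<lambda>(b1, b2).
     vector [Re (b1 * cnj b2), Im (b1 * cnj b2), ((cmod b1)\<^sup>2 - (cmod b2)\<^sup>2) / 2])"

definition J_nm :: "nat \<Rightarrow> nat \<Rightarrow> complex \<times> complex \<Rightarrow> real ^ 3" where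
  "J_nm n m = J_11 \<circ> f_nm n m"

definition R_level :: "nat \<Rightarrow> nat \<Rightarrow> real \<Rightarrow> (complex \<times> complex) set" where
  "R_level n m r = {a \<in> Ctimes2. R_nm n m a = r}"

definition kummer_shape :: "nat \<Rightarrow> nat \<Rightarrow> real \<Rightarrow> (real ^ 3) set" where
  "kummer_shape n m r = J_nm n m ` R_level n m r"

end

theory Submission
  imports Defs
begin

text \<open>
  Each coordinate of \<^const>\<open>f_nm\<close> multiplies the argument of a nonzero complex number by a positive
  integer \<open>k\<close> and divides its modulus by \<open>sqrt k\<close>. It therefore maps the punctured plane onto
  itself, and the weights in \<^const>\<open>R_nm\<close> are exactly those that turn \<open>R_nm n m\<close> into
  \<open>R_nm 1 1 \<circ> f_nm n m\<close>. So \<^const>\<open>f_nm\<close> carries the level set of \<open>R_nm n m\<close> onto that of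
  \<open>R_nm 1 1\<close> (\<open>f_nm_image_R_level\<close>), and the resonance \<open>n:m\<close> disappears from the problem.

  What remains is the Hopf map \<^const>\<open>J_11\<close> on a 3-sphere. The identity
  \<open>|b1|\<^sup>2 |b2|\<^sup>2 + ((|b1|\<^sup>2 - |b2|\<^sup>2) / 2)\<^sup>2 = ((|b1|\<^sup>2 + |b2|\<^sup>2) / 2)\<^sup>2\<close> puts its values on the sphere
  of radius \<open>r\<close>, and the vanishing of a coordinate, \<open>b1 * b2 = 0\<close>, corresponds to the two poles.
  An explicit section away from the poles shows that every other point is attained
  (\<open>J_11_image_R_level\<close>).
\<close>

definition winding_map :: "nat \<Rightarrow> complex \<Rightarrow> complex" where
  "winding_map k z = z ^ k / complex_of_real (sqrt (real k) * cmod z ^ (k - 1))"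

lemma f_nm_winding_map: "f_nm n m (a1, a2) = (winding_map m a1, winding_map n a2)"
  by (simp add: f_nm_def winding_map_def)

lemma cmod_winding_map:
  assumes "k > 0" "z \<noteq> 0"
  shows "cmod (winding_map k z) = cmod z / sqrt (real k)"
proof -
  obtain j where k: "k = Suc j"
    using assms(1) gr0_implies_Suc by blast
  show ?thesis
    using assms(2) unfolding winding_map_def k
    by (simp add: norm_divide norm_mult norm_power del: of_nat_Suc)
qed

text \<open>In polar coordinates a preimage is found by dividing the argument by \<open>k\<close> and undoing the
  scaling of the modulus.\<close>

lemma winding_map_surj:
  assumes "k > 0" "b \<noteq> 0"
  obtains a where "a \<noteq> 0" "winding_map k a = b"
proof
  define s where "s = sqrt (real k) * cmod b"
  define a where "a = complex_of_real s * cis (Arg b / real k)"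
  have s: "s > 0" using assms by (simp add: s_def)
  show "a \<noteq> 0" using s by (simp add: a_def)
  obtain j where k: "k = Suc j"
    using assms(1) gr0_implies_Suc by blast
  have arg: "real k * (Arg b / real k) = Arg b" using assms(1) by simp
  have "cmod a = s" using s by (simp add: a_def norm_mult)
  moreover have "a ^ k = complex_of_real s ^ k * cis (Arg b)"
    unfolding a_def power_mult_distrib Complex.DeMoivre arg ..
  ultimately have "winding_map k a
      = complex_of_real s ^ k * cis (Arg b) / complex_of_real (sqrt (real k) * s ^ (k - 1))"
    by (simp add: winding_map_def)
  also have "\<dots> = complex_of_real s / complex_of_real (sqrt (real k)) * cis (Arg b)"
    using s by (simp add: k field_simps del: of_nat_Suc)
  also have "\<dots> = complex_of_real (cmod b) * cis (Arg b)"
    using assms(1) by (simp add: s_def)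
  also have "\<dots> = b"
    using rcis_cmod_Arg[of b] by (simp add: rcis_def)
  finally show "winding_map k a = b" .
qed

text \<open>The factor \<open>1 / sqrt k\<close> in \<^const>\<open>winding_map\<close> becomes, after squaring, the weight \<open>1 / k\<close> in
  \<^const>\<open>R_nm\<close>.\<close>

lemma R_nm_eq_R_11_f_nm:
  assumes "n > 0" "m > 0" "a \<in> Ctimes2"
  shows "R_nm 1 1 (f_nm n m a) = R_nm n m a"
  using assms
  by (cases a) (simp add: Ctimes2_def R_nm_def f_nm_winding_map cmod_winding_map power_divide)

lemma f_nm_image_Ctimes2:
  assumes "n > 0" "m > 0"
  shows "f_nm n m ` Ctimes2 = Ctimes2"
proof
  have "winding_map k z \<noteq> 0" if "k > 0" "z \<noteq> 0" for k z
    using cmod_winding_map[OF that] that by auto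
  then show "f_nm n m ` Ctimes2 \<subseteq> Ctimes2"
    using assms by (auto simp: Ctimes2_def f_nm_winding_map)
next
  show "Ctimes2 \<subseteq> f_nm n m ` Ctimes2"
  proof
    fix b assume "b \<in> Ctimes2"
    then obtain b1 b2 where b: "b = (b1, b2)" "b1 \<noteq> 0" "b2 \<noteq> 0"
      by (auto simp: Ctimes2_def)
    obtain a1 where a1: "a1 \<noteq> 0" "winding_map m a1 = b1"
      using winding_map_surj assms(2) b(2) by blast
    obtain a2 where a2: "a2 \<noteq> 0" "winding_map n a2 = b2"
      using winding_map_surj assms(1) b(3) by blast
    have "b = f_nm n m (a1, a2)" "(a1, a2) \<in> Ctimes2"
      using a1 a2 b by (simp_all add: f_nm_winding_map Ctimes2_def)
    then show "b \<in> f_nm n m ` Ctimes2" by blast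
  qed
qed

lemma f_nm_image_R_level:
  assumes "n > 0" "m > 0"
  shows "f_nm n m ` R_level n m r = R_level 1 1 r"
proof -
  have "R_level n m r = {a \<in> Ctimes2. R_nm 1 1 (f_nm n m a) = r}"
    unfolding R_level_def by (rule Collect_cong) (metis R_nm_eq_R_11_f_nm[OF assms])
  then have "f_nm n m ` R_level n m r = {b \<in> f_nm n m ` Ctimes2. R_nm 1 1 b = r}"
    by blast
  then show ?thesis
    unfolding f_nm_image_Ctimes2[OF assms] R_level_def .
qed

lemma sum_squares_J_11:
  "(J_11 b $ 1)\<^sup>2 + (J_11 b $ 2)\<^sup>2 + (J_11 b $ 3)\<^sup>2 = (R_nm 1 1 b)\<^sup>2"
proof -
  obtain b1 b2 where b: "b = (b1, b2)" by (cases b)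
  have "(Re (b1 * cnj b2))\<^sup>2 + (Im (b1 * cnj b2))\<^sup>2 = (cmod b1)\<^sup>2 * (cmod b2)\<^sup>2"
    by (metis cmod_power2 complex_mod_cnj norm_mult power_mult_distrib)
  then have "(J_11 b $ 1)\<^sup>2 + (J_11 b $ 2)\<^sup>2 + (J_11 b $ 3)\<^sup>2
      = (cmod b1)\<^sup>2 * (cmod b2)\<^sup>2 + (((cmod b1)\<^sup>2 - (cmod b2)\<^sup>2) / 2)\<^sup>2"
    unfolding b J_11_def case_prod_conv vector_3 by simp
  also have "\<dots> = (((cmod b1)\<^sup>2 + (cmod b2)\<^sup>2) / 2)\<^sup>2"
    by (simp add: field_simps power2_eq_square)
  finally show ?thesis
    by (simp add: b R_nm_def)
qed

lemma vec3_eq_iff: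
  fixes v :: "real ^ 3"
  shows "v = vector [x, y, z] \<longleftrightarrow> v $ 1 = x \<and> v $ 2 = y \<and> v $ 3 = z"
  by (auto simp: vec_eq_iff forall_3)

text \<open>The poles are missed because \<open>\<mu>1 + i \<mu>2 = b1 * cnj b2\<close> cannot vanish on \<^const>\<open>Ctimes2\<close>.
  Conversely, a point of the sphere with \<open>\<mu>1 + i \<mu>2 \<noteq> 0\<close> has \<open>|\<mu>3| < r\<close>, which leaves room for the
  moduli \<open>|b1|\<^sup>2 = r + \<mu>3\<close> and \<open>|b2|\<^sup>2 = r - \<mu>3\<close>, both positive.\<close>

lemma J_11_image_R_level:
  assumes "r > 0"
  shows "J_11 ` R_level 1 1 r
           = {\<mu> :: real ^ 3. (\<mu> $ 1)\<^sup>2 + (\<mu> $ 2)\<^sup>2 + (\<mu> $ 3)\<^sup>2 = r\<^sup>2}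
             - {vector [0, 0, r], vector [0, 0, - r]}" (is "_ = ?S - ?P")
proof
  show "J_11 ` R_level 1 1 r \<subseteq> ?S - ?P"
  proof
    fix \<mu> assume "\<mu> \<in> J_11 ` R_level 1 1 r"
    then obtain b1 b2 where \<mu>: "\<mu> = J_11 (b1, b2)" and nz: "b1 \<noteq> 0" "b2 \<noteq> 0"
        and R: "R_nm 1 1 (b1, b2) = r"
      by (auto simp: R_level_def Ctimes2_def)
    have "\<mu> \<in> ?S"
      using sum_squares_J_11[of "(b1, b2)"] R \<mu> by simp
    moreover have "\<mu> $ 1 \<noteq> 0 \<or> \<mu> $ 2 \<noteq> 0"
      using nz by (metis (no_types, lifting) J_11_def \<mu> case_prod_conv complex_cnj_zero_iff
          complex_eq_iff mult_eq_0_iff vector_3(1,2) zero_complex.sel)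
    ultimately show "\<mu> \<in> ?S - ?P"
      by (auto simp: vec3_eq_iff)
  qed
next
  show "?S - ?P \<subseteq> J_11 ` R_level 1 1 r"
  proof
    fix \<mu> assume \<mu>: "\<mu> \<in> ?S - ?P"
    define x y z where "x = \<mu> $ 1" "y = \<mu> $ 2" "z = \<mu> $ 3"
    note xyz = this
    have sph: "x\<^sup>2 + y\<^sup>2 = r\<^sup>2 - z\<^sup>2" using \<mu> by (simp add: xyz)
    have "x \<noteq> 0 \<or> y \<noteq> 0"
      using \<mu> sph by (auto simp: vec3_eq_iff xyz power2_eq_iff)
    then have "x\<^sup>2 + y\<^sup>2 > 0"
      by (simp add: sum_power2_gt_zero_iff)
    then have "\<bar>z\<bar>\<^sup>2 < r\<^sup>2"
      unfolding power2_abs using sph by linarith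
    then have "\<bar>z\<bar> < r"
      using assms by (rule power2_less_imp_less[OF _ less_imp_le])
    then have rz: "r + z > 0" by linarith
    \<comment> \<open>Over a point other than the poles, each Hopf fibre contains exactly one point with
      \<open>b1\<close> positive; then \<open>|b1|\<^sup>2 = r + \<mu>3\<close> is forced, and \<open>b1 * cnj b2 = \<mu>1 + i \<mu>2\<close> determines \<open>b2\<close>.\<close>
    define s where "s = sqrt (r + z)"
    define b1 where "b1 = complex_of_real s"
    define b2 where "b2 = Complex (x / s) (- y / s)"
    have s: "s > 0" "s\<^sup>2 = r + z" using rz by (simp_all add: s_def)
    have b1: "(cmod b1)\<^sup>2 = r + z" by (simp add: b1_def s)
    have "(cmod b2)\<^sup>2 = (x\<^sup>2 + y\<^sup>2) / (r + z)"
      by (simp add: b2_def cmod_power2 power_divide s add_divide_distrib)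
    also have "\<dots> = (r + z) * (r - z) / (r + z)"
      unfolding sph by (simp add: power2_eq_square algebra_simps)
    also have "\<dots> = r - z"
      using rz by simp
    finally have b2: "(cmod b2)\<^sup>2 = r - z" .
    have "b1 \<noteq> 0" "b2 \<noteq> 0"
      using s \<open>x \<noteq> 0 \<or> y \<noteq> 0\<close> by (auto simp: b1_def b2_def complex_eq_iff)
    then have "(b1, b2) \<in> R_level 1 1 r"
      by (simp add: R_level_def Ctimes2_def R_nm_def b1 b2)
    moreover have "\<mu> = J_11 (b1, b2)"
      using s(1) unfolding J_11_def case_prod_conv b1 b2 vec3_eq_iff
      by (simp add: b1_def b2_def xyz)
    ultimately show "\<mu> \<in> J_11 ` R_level 1 1 r" by blast
  qed
qed

lemma sphere_vec3_eq:
  assumes "r \<ge> 0"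
  shows "sphere (0 :: real ^ 3) r = {\<mu>. (\<mu> $ 1)\<^sup>2 + (\<mu> $ 2)\<^sup>2 + (\<mu> $ 3)\<^sup>2 = r\<^sup>2}"
  using assms
  by (auto simp: norm_vec_def L2_set_def sum_3 real_sqrt_unique)

theorem corollary2p2:
  fixes n m :: nat and r :: real
  assumes "n > 0" and "m > 0" and "r > 0"
  shows "kummer_shape n m r
           = {\<mu> :: real ^ 3. (\<mu> $ 1)\<^sup>2 + (\<mu> $ 2)\<^sup>2 + (\<mu> $ 3)\<^sup>2 = r\<^sup>2}
             - {vector [0, 0, r], vector [0, 0, - r]}
       \<and> (\<forall>a \<in> R_level n m r.
            kummer_shape n m r
              = sphere (0 :: real ^ 3) (R_nm n m a)
                - {vector [0, 0, R_nm n m a], vector [0, 0, - R_nm n m a]})"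
proof -
  have "kummer_shape n m r = J_11 ` R_level 1 1 r"
    unfolding kummer_shape_def J_nm_def image_comp[symmetric] f_nm_image_R_level[OF assms(1,2)] ..
  then have "kummer_shape n m r
           = {\<mu> :: real ^ 3. (\<mu> $ 1)\<^sup>2 + (\<mu> $ 2)\<^sup>2 + (\<mu> $ 3)\<^sup>2 = r\<^sup>2}
             - {vector [0, 0, r], vector [0, 0, - r]}"
    using J_11_image_R_level[OF assms(3)] by simp
  moreover have "R_nm n m a = r" if "a \<in> R_level n m r" for a
    using that by (simp add: R_level_def)
  ultimately show ?thesis
    by (simp add: sphere_vec3_eq[OF less_imp_le[OF assms(3)]])
qed

end
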